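(* Let $G$ be a graph and let $(G,\sigma)$ and $(G,\sigma')$ be switching equivalent signed graphs. Then for every positive integer $n$, $(G,\sigma)$ admits a signed tree-$n$-coloring if and only if $(G,\sigma')$ admits a signed tree-$n$-coloring. Hence $va(G,\sigma)=va(G,\sigma')$.
   Context: All graphs are finite, simple and undirected. A signed graph $(G,\sigma)$ is a graph $G$ with a signature $\sigma:E(G)\to\{1,-1\}$; edges with signature $1$ (resp. $-1$) are positive (resp. negative). Switching a vertex $u$ of $(G,\sigma)$ means negating the signs of all edges incident with $u$. Two signed graphs $(G,\sigma)$ and $(G,\sigma')$ on the same graph are switching equivalent if one is obtained from the other by a series of vertex switchings. Colors are integers. For a vertex coloring $c:V(G)\to\mathbb{Z}$ and a color $i$, $G^{c}(i,\pm)$ denotes the subgraph of $G$ whose vertices are those colored $i$ or $-i$, and whose edges are the positive edges with both ends colored $i$ or both ends colored $-i$, together with the negative edges with one end colored $i$ and the other colored $-i$. (Equivalently, the edges $uv$ with $c(u)=\sigma(uv)c(v)\in\{i,-i\}$; in particular for $i=0$ every edge joining two vertices colored $0$ is included.) A signed tree-coloring of $(G,\sigma)$ is a vertex coloring $c$ such that $G^{c}(i,\pm)$ is a forest for every color $i=c(u)$, $u\in V(G)$. Let $M_n=\{\pm1,\dots,\pm k\}$ if $n=2k$ and $M_n=\{0,\pm1,\dots,\pm k\}$ if $n=2k+1$. A signed tree-$n$-coloring is a signed tree-coloring $c:V(G)\to M_n$. The signed vertex arboricity $va(G,\sigma)$ is the minimum $n$ such that $(G,\sigma)$ admits a signed tree-$n$-coloring.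 *)

theory Defs
  imports Main
begin

record 'a ugraph =
  verts :: "'a set"
  edges :: "'a set set"

definition simple_graph :: "'a ugraph \<Rightarrow> bool" where
  "simple_graph G \<longleftrightarrow> finite (verts G) \<and> (\<forall>e\<in>edges G. e \<subseteq> verts G \<and> card e = 2)"

definition is_cycle :: "'a ugraph \<Rightarrow> 'a list \<Rightarrow> bool" where
  "is_cycle G p \<longleftrightarrow> length p \<ge> 3 \<and> distinct p \<and> set p \<subseteq> verts G \<and>
     (\<forall>k<length p. {p ! k, p ! (Suc k mod length p)} \<in> edges G)"

definition is_forest :: "'a ugraph \<Rightarrow> bool" where
  "is_forest G \<longleftrightarrow> (\<nexists>p. is_cycle G p)"

(* A signature is a total function of which only the values on the edges of G matter. *)
definition is_signature :: "'a ugraph \<Rightarrow> ('a set \<Rightarrow> int) \<Rightarrow> bool" where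
  "is_signature G \<sigma> \<longleftrightarrow> (\<forall>e\<in>edges G. \<sigma> e \<in> {1, -1})"

definition switch :: "'a \<Rightarrow> ('a set \<Rightarrow> int) \<Rightarrow> ('a set \<Rightarrow> int)" where
  "switch u \<sigma> = (\<lambda>e. if u \<in> e then - \<sigma> e else \<sigma> e)"

(* The list us is the series of switched vertices; signatures are compared on edges only. *)
definition switching_equivalent ::
  "'a ugraph \<Rightarrow> ('a set \<Rightarrow> int) \<Rightarrow> ('a set \<Rightarrow> int) \<Rightarrow> bool" where
  "switching_equivalent G \<sigma> \<sigma>' \<longleftrightarrow>
     (\<exists>us. set us \<subseteq> verts G \<and> (\<forall>e\<in>edges G. \<sigma>' e = fold switch us \<sigma> e))"

(* The graph G^c(i,+-).  For i = 0 it contains every edge joining two vertices coloured 0. *)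
definition colour_subgraph ::
  "'a ugraph \<Rightarrow> ('a set \<Rightarrow> int) \<Rightarrow> ('a \<Rightarrow> int) \<Rightarrow> int \<Rightarrow> 'a ugraph" where
  "colour_subgraph G \<sigma> c i =
     \<lparr> verts = {v \<in> verts G. c v = i \<or> c v = - i},
       edges = {{u, v} | u v. {u, v} \<in> edges G \<and>
         (\<sigma> {u, v} = 1 \<and> (c u = i \<and> c v = i \<or> c u = - i \<and> c v = - i) \<or>
          \<sigma> {u, v} = - 1 \<and> c u = i \<and> c v = - i)} \<rparr>"

definition signed_tree_colouring ::
  "'a ugraph \<Rightarrow> ('a set \<Rightarrow> int) \<Rightarrow> ('a \<Rightarrow> int) \<Rightarrow> bool" where
  "signed_tree_colouring G \<sigma> c \<longleftrightarrow> (\<forall>u\<in>verts G. is_forest (colour_subgraph G \<sigma> c (c u)))"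

definition colour_set :: "nat \<Rightarrow> int set" where
  "colour_set n = {i. 1 \<le> \<bar>i\<bar> \<and> \<bar>i\<bar> \<le> int (n div 2)} \<union> (if odd n then {0} else {})"

definition signed_tree_colourable :: "'a ugraph \<Rightarrow> ('a set \<Rightarrow> int) \<Rightarrow> nat \<Rightarrow> bool" where
  "signed_tree_colourable G \<sigma> n \<longleftrightarrow>
     (\<exists>c. (\<forall>u\<in>verts G. c u \<in> colour_set n) \<and> signed_tree_colouring G \<sigma> c)"

(* By ex_signed_tree_colourable the minimum exists for every simple graph. *)
definition signed_vertex_arboricity :: "'a ugraph \<Rightarrow> ('a set \<Rightarrow> int) \<Rightarrow> nat" where
  "signed_vertex_arboricity G \<sigma> = (LEAST n. signed_tree_colourable G \<sigma> n)"

lemma ex_signed_tree_colourable: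
  assumes "simple_graph G"
  shows "\<exists>n. signed_tree_colourable G \<sigma> n"
proof -
  have "finite (verts G)"
    using assms by (simp add: simple_graph_def)
  then obtain f and m :: nat where f: "f ` verts G = {i. i < m}" "inj_on f (verts G)"
    using finite_imp_inj_to_nat_seg by blast
  define c where "c v = int (f v) + 1" for v
  have col: "\<forall>u\<in>verts G. c u \<in> colour_set (2 * m)"
  proof
    fix u assume "u \<in> verts G"
    then have "f u < m" using f(1) by blast
    then show "c u \<in> colour_set (2 * m)" by (simp add: c_def colour_set_def)
  qed
  have "is_forest (colour_subgraph G \<sigma> c (c u))" if u: "u \<in> verts G" for u
    unfolding is_forest_def
  proof
    assume "\<exists>p. is_cycle (colour_subgraph G \<sigma> c (c u)) p"
    then obtain p where p: "length p \<ge> 3" "distinct p"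
      "set p \<subseteq> verts (colour_subgraph G \<sigma> c (c u))"
      by (auto simp: is_cycle_def)
    have "set p \<subseteq> {u}"
      using p(3) f(2) u by (fastforce simp: colour_subgraph_def c_def inj_on_def)
    then have "card (set p) \<le> 1"
      using card_mono[of "{u}" "set p"] by simp
    with p(1,2) show False
      by (simp add: distinct_card)
  qed
  with col show ?thesis
    by (auto simp: signed_tree_colourable_def signed_tree_colouring_def)
qed

end

theory Submission
  imports Defs
begin

text \<open>
  Negating the colour of \<open>u\<close> compensates for switching \<open>u\<close>. An edge \<open>{a, b}\<close> lies in the
  subgraph of colour \<open>i\<close> exactly if \<open>c a \<in> {i, -i}\<close> and \<open>c a = \<sigma> {a, b} * c b\<close>
  (\<open>edge_colour_subgraph_iff\<close>). Switching \<open>u\<close> and negating \<open>c u\<close> at once changes this equation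
  only for edges at \<open>u\<close>, and there it flips two signs; hence all colour subgraphs stay literally
  the same (\<open>colour_subgraph_switch\<close>). Every set \<open>M\<^sub>n\<close> is closed under negation, so the new
  colouring uses admissible colours. Since switching is an involution, colourability is invariant
  under one switching, and therefore under any series of them. As this holds for every \<open>n\<close>,
  the two minima agree.
\<close>

text \<open>
  Both edge types of the definition merge into one equation, symmetric in the two ends because
  \<open>\<sigma> {a, b}\<close> is its own inverse. This removes the case analysis on signs and orientations.
\<close>

lemma edge_colour_subgraph_iff:
  assumes "is_signature G \<sigma>"
  shows "{a, b} \<in> edges (colour_subgraph G \<sigma> c i) \<longleftrightarrow>
    {a, b} \<in> edges G \<and> c a \<in> {i, - i} \<and> c a = \<sigma> {a, b} * c b"
proof (cases "{a, b} \<in> edges G")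
  case True
  then have "\<sigma> {a, b} = 1 \<or> \<sigma> {a, b} = - 1"
    using assms by (auto simp: is_signature_def)
  moreover have "{a, b} \<in> edges (colour_subgraph G \<sigma> c i) \<longleftrightarrow>
      \<sigma> {a, b} = 1 \<and> (c a = i \<and> c b = i \<or> c a = - i \<and> c b = - i) \<or>
      \<sigma> {a, b} = - 1 \<and> (c a = i \<and> c b = - i \<or> c b = i \<and> c a = - i)"
  proof -
    have "(\<exists>u v. {a, b} = {u, v} \<and> P u v) \<longleftrightarrow> P a b \<or> P b a" for P
      by (auto simp: doubleton_eq_iff)
    then show ?thesis
      using True by (auto simp: colour_subgraph_def insert_commute)
  qed
  ultimately show ?thesis
    using True by auto
next
  case False
  then show ?thesis
    by (auto simp: colour_subgraph_def)
qed

lemma colour_subgraph_eqI: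
  assumes "simple_graph G" and "is_signature G \<sigma>" and "is_signature G \<tau>"
    and verts: "\<And>v. v \<in> verts G \<Longrightarrow> c v \<in> {i, - i} \<longleftrightarrow> d v \<in> {j, - j}"
    and edges: "\<And>a b. \<lbrakk>{a, b} \<in> edges G; a \<noteq> b\<rbrakk> \<Longrightarrow>
      c a = \<sigma> {a, b} * c b \<longleftrightarrow> d a = \<tau> {a, b} * d b"
  shows "colour_subgraph G \<sigma> c i = colour_subgraph G \<tau> d j"
proof -
  have "e \<in> edges (colour_subgraph G \<sigma> c i) \<longleftrightarrow> e \<in> edges (colour_subgraph G \<tau> d j)" for e
  proof (cases "e \<in> edges G")
    case True
    then obtain a b where ab: "e = {a, b}" "a \<noteq> b" "a \<in> verts G"
      using assms(1) by (auto simp: simple_graph_def card_2_iff)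
    show ?thesis
      using True ab(2) verts[OF ab(3)] edges[of a b] unfolding ab(1)
      by (simp only: edge_colour_subgraph_iff[OF assms(2)] edge_colour_subgraph_iff[OF assms(3)])
        simp
  next
    case False
    then show ?thesis
      by (auto simp: colour_subgraph_def)
  qed
  then have "edges (colour_subgraph G \<sigma> c i) = edges (colour_subgraph G \<tau> d j)"
    by blast
  moreover have "verts (colour_subgraph G \<sigma> c i) = verts (colour_subgraph G \<tau> d j)"
    using verts by (auto simp: colour_subgraph_def)
  ultimately show ?thesis
    by simp
qed

lemma is_signature_switch:
  "is_signature G \<sigma> \<Longrightarrow> is_signature G (switch u \<sigma>)"
  by (auto simp: is_signature_def switch_def)

lemma switch_switch: "switch u (switch u \<sigma>) = \<sigma>"
  by (auto simp: switch_def)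

text \<open>
  An edge has two distinct ends, so at an edge containing \<open>u\<close> the sign and exactly one of the two
  colours are negated; a loop at \<open>u\<close> would break the equation.
\<close>

lemma colour_subgraph_switch:
  assumes "simple_graph G" and "is_signature G \<sigma>"
  shows "colour_subgraph G (switch u \<sigma>) (c(u := - c u)) i = colour_subgraph G \<sigma> c i"
  using assms is_signature_switch[OF assms(2)]
  by (intro colour_subgraph_eqI) (auto simp: switch_def)

text \<open>
  After switching \<open>u\<close> the forest condition at \<open>u\<close> speaks of the colour \<open>- c u\<close>; it is the old
  condition because the subgraph depends on the colour only up to sign.
\<close>

lemma colour_subgraph_uminus:
  assumes "simple_graph G" and "is_signature G \<sigma>"
  shows "colour_subgraph G \<sigma> c (- i) = colour_subgraph G \<sigma> c i"
  using assms by (intro colour_subgraph_eqI) auto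

lemma signed_tree_colouring_switch:
  assumes "simple_graph G" and "is_signature G \<sigma>" and "signed_tree_colouring G \<sigma> c"
  shows "signed_tree_colouring G (switch u \<sigma>) (c(u := - c u))"
  using assms(3)
  by (auto simp: signed_tree_colouring_def
      colour_subgraph_switch[OF assms(1,2)] colour_subgraph_uminus[OF assms(1,2)])

lemma colour_set_uminus: "i \<in> colour_set n \<Longrightarrow> - i \<in> colour_set n"
  by (auto simp: colour_set_def split: if_splits)

lemma signed_tree_colourable_switchI:
  assumes "simple_graph G" and "is_signature G \<sigma>" and "signed_tree_colourable G \<sigma> n"
  shows "signed_tree_colourable G (switch u \<sigma>) n"
proof -
  obtain c where c: "\<forall>v\<in>verts G. c v \<in> colour_set n" "signed_tree_colouring G \<sigma> c"
    using assms(3) by (auto simp: signed_tree_colourable_def)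
  have "\<forall>v\<in>verts G. (c(u := - c u)) v \<in> colour_set n"
    using c(1) by (simp add: colour_set_uminus)
  then show ?thesis
    using signed_tree_colouring_switch[OF assms(1,2) c(2)]
    unfolding signed_tree_colourable_def by blast
qed

lemma signed_tree_colourable_switch:
  assumes "simple_graph G" and "is_signature G \<sigma>"
  shows "signed_tree_colourable G (switch u \<sigma>) n \<longleftrightarrow> signed_tree_colourable G \<sigma> n"
  using signed_tree_colourable_switchI[OF assms]
    signed_tree_colourable_switchI[OF assms(1) is_signature_switch[OF assms(2)], of u n u]
  by (auto simp: switch_switch)

lemma signed_tree_colourable_fold_switch:
  assumes "simple_graph G" and "is_signature G \<sigma>"
  shows "signed_tree_colourable G (fold switch us \<sigma>) n \<longleftrightarrow> signed_tree_colourable G \<sigma> n"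
  using assms(2)
  by (induction us arbitrary: \<sigma>)
    (simp_all add: is_signature_switch signed_tree_colourable_switch[OF assms(1)])

text \<open>
  Switching equivalence determines the signature only on edges, so the result of the series of
  switchings still has to be exchanged for \<open>\<sigma>'\<close>.
\<close>

lemma signed_tree_colourable_cong:
  assumes "\<And>e. e \<in> edges G \<Longrightarrow> \<sigma> e = \<tau> e"
  shows "signed_tree_colourable G \<sigma> n \<longleftrightarrow> signed_tree_colourable G \<tau> n"
proof -
  have "colour_subgraph G \<sigma> c i = colour_subgraph G \<tau> c i" for c i
    unfolding colour_subgraph_def using assms by (simp cong: conj_cong)
  then show ?thesis
    by (simp add: signed_tree_colourable_def signed_tree_colouring_def)
qed

theorem theorem2:
  fixes G :: "'a ugraph" and \<sigma> \<sigma>' :: "'a set \<Rightarrow> int"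
  assumes "simple_graph G"
    and "is_signature G \<sigma>" and "is_signature G \<sigma>'"
    and "switching_equivalent G \<sigma> \<sigma>'"
  shows "(\<forall>n::nat. n > 0 \<longrightarrow> (signed_tree_colourable G \<sigma> n \<longleftrightarrow> signed_tree_colourable G \<sigma>' n)) \<and>
         signed_vertex_arboricity G \<sigma> = signed_vertex_arboricity G \<sigma>'"
proof -
  obtain us where us: "\<And>e. e \<in> edges G \<Longrightarrow> \<sigma>' e = fold switch us \<sigma> e"
    using assms(4) by (auto simp: switching_equivalent_def)
  have "signed_tree_colourable G \<sigma> n \<longleftrightarrow> signed_tree_colourable G \<sigma>' n" for n
    using signed_tree_colourable_cong[of G, OF us]
      signed_tree_colourable_fold_switch[OF assms(1,2)] by simp
  then show ?thesis
    by (simp add: signed_vertex_arboricity_def)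
qed

end
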